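(* Let $A\in\mathbb{R}^{m\times n}$ have the factorization $$A=P\begin{pmatrix} I & \\ E & I\end{pmatrix}\begin{pmatrix} A_{11} & A_{12}\\ & S\end{pmatrix},\qquad S=A_{22}-EA_{12},\quad E=A_{21}A_{11}^{-1},$$ with $A_{11}=A_{\mathcal{I},\mathcal{J}}$ and $k=|\mathcal{J}|$ (notation as in the context). Let $\widehat{\mathcal{J}}$ be obtained from a uniform random sampling of $\{1:n\}\setminus\mathcal{J}$ with $|\widehat{\mathcal{J}}|=b$, and let $\mathcal{L}$ be given by $(\{1:n\}\setminus\mathcal{J})\circ\mathcal{L}=\widehat{\mathcal{J}}$. Let $\theta=\frac{n-k}{b}\Vert S_{:,\mathcal{L}}\Vert_{F}^{2}$ and $\mathcal{E}=A-UA_{\mathcal{I},:}$, where $U=P\begin{pmatrix} I\\ E\end{pmatrix}$. Then $$\operatorname{E}(\theta)=\Vert\mathcal{E}\Vert_{F}^{2}.$$ If the factorization is further assumed to satisfy, with $c\geq 1$ and $f\geq1$ as in the context, for $1\leq i\leq k$, $1\leq j\leq\min\{m,n\}-k$, $$\sigma_{i}(A_{11})\geq\frac{\sigma_{i}(A)}{f},\quad\sigma_{j}(S)\leq\sigma_{k+j}(A)f,\quad\Vert A_{11}^{-1}A_{12}\Vert_{\max}\leq c,$$ then $$\Pr\left(\left\vert\theta-\Vert\mathcal{E}\Vert_{F}^{2}\right\vert\geq((n-k)f^{2})(\sigma_{k+1}(A))^{2}\right)\leq2\exp(-2b).$$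
   Context: $\sigma_i(\cdot)$ denotes the $i$-th largest singular value; $\Vert\cdot\Vert_{\max}$ is the largest entrywise magnitude; $\Vert\cdot\Vert_F$ is the Frobenius norm; $\operatorname{E}(\cdot)$ and $\Pr$ are expectation and probability with respect to the random choice of $\widehat{\mathcal{J}}$; $1:n$ stands for $1,\ldots,n$. Setting: $A$ is fixed, $\mathcal{I}\subset\{1:m\}$ and $\mathcal{J}\subset\{1:n\}$ are fixed with $|\mathcal{I}|=|\mathcal{J}|=k$, $A_{11}=A_{\mathcal{I},\mathcal{J}}$ (submatrix with rows $\mathcal{I}$, columns $\mathcal{J}$) is nonsingular, and $A_{\mathcal{I},:}$ is the submatrix of the rows $\mathcal{I}$. The columns of $A$ are assumed permuted so that those of $\mathcal{J}$ come first, and $P$ is a permutation matrix with $P^TA=\begin{pmatrix} A_{11} & A_{12}\\ A_{21} & A_{22}\end{pmatrix}$, where the first block row is formed by the rows $\mathcal{I}$. The index set $\mathcal{I}$ comes from a rank-revealing factorization of the columns $\mathcal{J}$ of $A$, so that $\Vert E\Vert_{\max}\leq c$. The quantities $c\geq1$ and $f\geq1$ are low-degree polynomials in $m$, $n$, and $k$. The notation $(\{1:n\}\setminus\mathcal{J})\circ\mathcal{L}$ is the subset of $\{1:n\}\setminus\mathcal{J}$ consisting of its entries at the positions listed in $\mathcal{L}$; thus $S_{:,\mathcal{L}}$ consists of the $b$ columns of the $(m-k)\times(n-k)$ matrix $S$ corresponding to the columns $\widehat{\mathcal{J}}$ of $A$.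
   Formalization: The probability bound is stated under the extra assumption σ_{k+1}(A) > 0; if σ_{k+1}(A) = 0 (including k = m), then S = 0, θ = ‖ℰ‖_F² = 0 and the event has probability 1, so the bound as printed fails. *)

theory Defs
  imports
    "HOL-Probability.Probability"
    "Jordan_Normal_Form.Char_Poly"
    "Jordan_Normal_Form.Gauss_Jordan_Elimination"
    "Jordan_Normal_Form.DL_Submatrix"
begin

(* Rows and columns are numbered from 0, as everywhere in Jordan_Normal_Form; singular values
   are numbered from 1, so sing_val A 1 is the largest one. The real matrix A^T A is symmetric
   positive semidefinite, so its characteristic polynomial has dim_col A real roots counted with
   multiplicity. Hence sing_val A i makes sense for 1 <= i <= dim_col A, and it is 0 for
   dim_row A < i <= dim_col A. *)
definition sing_val :: "real mat \<Rightarrow> nat \<Rightarrow> real" where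
  "sing_val A i =
     sqrt (rev (sorted_list_of_multiset (proots (char_poly (A\<^sup>T * A)))) ! (i - 1))"

(* The inserted 0 only matters for matrices without entries. *)
definition max_norm :: "real mat \<Rightarrow> real" where
  "max_norm A = Max (insert 0 (abs ` elements_mat A))"

definition frob_norm :: "real mat \<Rightarrow> real" where
  "frob_norm A = sqrt (\<Sum>i<dim_row A. \<Sum>j<dim_col A. (A $$ (i, j))\<^sup>2)"

(* With P = perm_mat N p and p a permutation of {..<N}: row i of P^T A is row p i of A,
   and column j of A P is column p j of A. *)
definition perm_mat :: "nat \<Rightarrow> (nat \<Rightarrow> nat) \<Rightarrow> real mat" where
  "perm_mat N p = mat N N (\<lambda>(i, j). if i = p j then 1 else 0)"

(* The entries of a set X of naturals, listed increasingly, at the (0-based) positions in L. *)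
definition entries_at :: "nat set \<Rightarrow> nat set \<Rightarrow> nat set" where
  "entries_at X L = pick X ` L"

definition subset_samples :: "nat set \<Rightarrow> nat \<Rightarrow> nat set pmf" where
  "subset_samples X b = pmf_of_set {T. T \<subseteq> X \<and> card T = b}"

end

theory Submission
  imports Defs
begin

text \<open>
  Write \<open>N = n - k\<close> and let \<open>Y\<^sub>j\<close> be the squared norm of the column of the Schur complement \<open>S\<close>
  that belongs to the column \<open>j \<in> J'\<close> of \<open>A\<close>. Two facts reduce the theorem to statements about
  these numbers. The residual \<open>\<E>\<close> vanishes in the rows \<open>I\<close> and in the columns \<open>J\<close>, and elsewhere it
  is \<open>S\<close> up to a permutation of rows and columns (\<open>index_residual_permuted\<close>), so
  \<open>\<parallel>\<E>\<parallel>\<^sub>F\<^sup>2 = \<Sum>\<^bsub>j\<in>J'\<^esub> Y\<^sub>j\<close>. And \<open>\<theta> T = (N / b) \<Sum>\<^bsub>j\<in>T\<^esub> Y\<^sub>j\<close>, because the positions in \<open>L T\<close> are those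
  of the elements of \<open>T\<close> in \<open>J'\<close>.

  For the expectation, every \<open>j\<close> lies in a uniformly random \<open>b\<close>-element subset of \<open>J'\<close> with
  probability \<open>b / N\<close> (\<open>expectation_subset_samples_sum\<close>).

  For the tail bound, no column of \<open>S\<close> is longer than \<open>\<sigma>\<^sub>1(S) \<le> f \<sigma>\<^bsub>k+1\<^esub>(A)\<close>, so all \<open>Y\<^sub>j\<close> lie in
  \<open>[0, M]\<close> with \<open>M = f\<^sup>2 \<sigma>\<^bsub>k+1\<^esub>(A)\<^sup>2\<close>. The bound \<open>2 exp (- 2 b)\<close> is what Hoeffding's inequality
  for sampling without replacement gives for such \<open>Y\<^sub>j\<close>. But the deviation in question is \<open>N M\<close>, the
  full width of the interval that contains both \<open>\<theta> T\<close> and its expectation, and it is not attained when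
  \<open>M > 0\<close> (\<open>sampled_mean_deviation_lt\<close>). So the event has probability \<open>0\<close>.

  The remaining ingredient is that \<open>\<sigma>\<^sub>1(S)\<close>, defined through the real roots of the characteristic
  polynomial of \<open>S\<^sup>T S\<close>, bounds the column norms (\<open>sing_val_1_col_bounds\<close>). This is
  the variational description of the largest eigenvalue of a real symmetric matrix: the maximum of the
  Rayleigh quotient is attained, and at an eigenvector.
\<close>

section \<open>Largest eigenvalue of a real symmetric matrix\<close>

(* The dot stands for the product of vectors of type vec throughout. *)
no_notation inner (infix "\<bullet>" 70)

lemma self_scalar_prod_pos:
  fixes v :: "real vec"
  assumes "v \<in> carrier_vec n" "v \<noteq> 0\<^sub>v n"
  shows "0 < v \<bullet> v"
  using assms conjugate_square_ge_0_vec[of v] conjugate_square_eq_0_vec[of v n]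
  by (auto simp: order_le_less)

text \<open>
  Moving from a zero \<open>x\<close> of a nonnegative quadratic form in the direction \<open>z = M x\<close> changes the
  form by \<open>2 t (z \<bullet> z) + t\<^sup>2 (z \<bullet> M z)\<close>. If \<open>z\<close> were nonzero, the linear term would win
  for small negative \<open>t\<close> and the form would become negative.
\<close>
lemma real_symmetric_psd_null:
  fixes M :: "real mat"
  assumes M: "M \<in> carrier_mat n n" and sym: "M\<^sup>T = M"
    and psd: "\<And>v. v \<in> carrier_vec n \<Longrightarrow> 0 \<le> v \<bullet> (M *\<^sub>v v)"
    and x: "x \<in> carrier_vec n" "x \<bullet> (M *\<^sub>v x) = 0"
  shows "M *\<^sub>v x = 0\<^sub>v n"
proof (rule ccontr)
  assume neq: "M *\<^sub>v x \<noteq> 0\<^sub>v n"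
  define z where "z = M *\<^sub>v x"
  have z: "z \<in> carrier_vec n" and Mz: "M *\<^sub>v z \<in> carrier_vec n"
    using M x z_def by auto
  define a where "a = z \<bullet> z"
  define d where "d = 1 + \<bar>z \<bullet> (M *\<^sub>v z)\<bar>"
  \<comment> \<open>With this step, \<open>\<bar>t (z \<bullet> M z)\<bar> < a\<close>, so the linear term dominates.\<close>
  define t where "t = - a / d"
  have "a > 0"
    using self_scalar_prod_pos[OF z] neq by (simp add: a_def z_def)
  have "x \<bullet> (M *\<^sub>v z) = a"
    using transpose_vec_mult_scalar[OF M z x(1)] sym by (simp add: a_def z_def)
  then have expand: "(x + t \<cdot>\<^sub>v z) \<bullet> (M *\<^sub>v (x + t \<cdot>\<^sub>v z)) = 2 * t * a + t * t * (z \<bullet> (M *\<^sub>v z))"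
    using x M z Mz
    by (simp add: mult_add_distrib_mat_vec[of _ n n] mult_mat_vec[of _ n n] z_def[symmetric]
        add_scalar_prod_distrib[of _ n] scalar_prod_add_distrib[of _ n] a_def
        algebra_simps comm_scalar_prod[of x n])
  have "\<bar>t\<bar> * \<bar>z \<bullet> (M *\<^sub>v z)\<bar> < a"
  proof -
    have "a * \<bar>z \<bullet> (M *\<^sub>v z)\<bar> < a * d" using \<open>a > 0\<close> by (simp add: d_def)
    then show ?thesis using \<open>a > 0\<close> unfolding t_def d_def by (simp add: field_simps abs_div_pos)
  qed
  then have "0 < 2 * a + t * (z \<bullet> (M *\<^sub>v z))"
    using \<open>a > 0\<close> abs_ge_minus_self[of "t * (z \<bullet> (M *\<^sub>v z))"] by (simp add: abs_mult)
  moreover have "t < 0" using \<open>a > 0\<close> by (simp add: t_def d_def divide_neg_pos)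
  ultimately have "t * (2 * a + t * (z \<bullet> (M *\<^sub>v z))) < 0"
    by (simp add: mult_neg_pos)
  then have "(x + t \<cdot>\<^sub>v z) \<bullet> (M *\<^sub>v (x + t \<cdot>\<^sub>v z)) < 0"
    unfolding expand by (simp add: algebra_simps)
  with psd[of "x + t \<cdot>\<^sub>v z"] x z show False by simp
qed

text \<open>
  The quadratic form is continuous and the unit sphere is compact, so the form has a maximum on the
  sphere; homogeneity extends the bound to all vectors. The dimension is a term and not a
  type, so the sphere is realised inside the product space \<^typ>\<open>nat \<Rightarrow> real\<close>, where it is a
  closed subset of a product of compact sets.
\<close>
lemma rayleigh_max_attained:
  fixes B :: "real mat"
  assumes B: "B \<in> carrier_mat n n" and n: "n > 0"
  obtains x where "x \<in> carrier_vec n" "x \<bullet> x = 1"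
    "\<And>v. v \<in> carrier_vec n \<Longrightarrow> v \<bullet> (B *\<^sub>v v) \<le> (x \<bullet> (B *\<^sub>v x)) * (v \<bullet> v)"
proof -
  define box :: "(nat \<Rightarrow> real) set" where
    "box = PiE UNIV (\<lambda>i. if i < n then {-1..1} else {0})"
  define K where "K = box \<inter> {x. (\<Sum>i<n. (x i)\<^sup>2) = 1}"
  define R where "R = (\<lambda>x::nat \<Rightarrow> real. \<Sum>i<n. x i * (\<Sum>j<n. B $$ (i, j) * x j))"
  have R: "R x = vec n x \<bullet> (B *\<^sub>v vec n x)" for x
    using B by (simp add: R_def scalar_prod_def lessThan_atLeast0)
  have norm: "vec n x \<bullet> vec n x = (\<Sum>i<n. (x i)\<^sup>2)" for x :: "nat \<Rightarrow> real"
    by (simp add: scalar_prod_def lessThan_atLeast0 power2_eq_square)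
  have "compact box"
    using compactin_PiE[of "\<lambda>_. euclidean" UNIV "\<lambda>i. if i < n then {-1..1::real} else {0}"]
    by (simp add: box_def euclidean_product_topology)
  moreover have "closed {x::nat \<Rightarrow> real. (\<Sum>i<n. (x i)\<^sup>2) = 1}"
    by (intro closed_Collect_eq continuous_intros continuous_on_product_coordinates)
  ultimately have "compact K" unfolding K_def by (rule compact_Int_closed)
  moreover have "(\<lambda>i. if i = 0 then 1 else 0) \<in> K"
  proof -
    have "(\<Sum>i<n. (if i = 0 then 1 else 0 :: real)\<^sup>2) = (\<Sum>i<n. if i = 0 then 1 else 0)"
      by (intro sum.cong) auto
    then show ?thesis using n by (auto simp: K_def box_def)
  qed
  moreover have "continuous_on K R" unfolding R_def
    by (intro continuous_intros continuous_on_subset[OF continuous_on_product_coordinates subset_UNIV])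
  ultimately obtain x where x: "x \<in> K" "\<And>y. y \<in> K \<Longrightarrow> R y \<le> R x"
    using continuous_attains_sup[of K R] by blast
  show ?thesis
  proof
    show "vec n x \<in> carrier_vec n" "vec n x \<bullet> vec n x = 1"
      using x(1) by (simp_all add: norm K_def)
    fix v :: "real vec" assume v: "v \<in> carrier_vec n"
    show "v \<bullet> (B *\<^sub>v v) \<le> (vec n x \<bullet> (B *\<^sub>v vec n x)) * (v \<bullet> v)"
    proof (cases "v = 0\<^sub>v n")
      case True
      then show ?thesis using B by simp
    next
      case False
      define s where "s = sqrt (v \<bullet> v)"
      have pos: "v \<bullet> v > 0"
        using False v by (rule self_scalar_prod_pos[rotated])
      then have s: "s > 0" "s * s = v \<bullet> v" by (simp_all add: s_def)
      define y where "y = (\<lambda>i. if i < n then v $ i / s else 0)"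
      have y: "vec n y = (1 / s) \<cdot>\<^sub>v v" using v by (auto simp: y_def)
      have Ny: "(\<Sum>i<n. (y i)\<^sup>2) = 1"
        using s pos v unfolding norm[symmetric] y by simp
      have "y \<in> box"
      proof -
        have "(y i)\<^sup>2 \<le> 1" if "i < n" for i
          using that unfolding Ny[symmetric] by (intro member_le_sum) auto
        then have "\<bar>y i\<bar> \<le> 1" if "i < n" for i
          using that abs_square_le_1 by blast
        moreover have "y i = 0" if "\<not> i < n" for i using that by (simp add: y_def)
        ultimately show ?thesis by (auto simp: box_def abs_le_iff minus_le_iff)
      qed
      then have "R y \<le> R x" using x(2) Ny by (simp add: K_def)
      moreover have "R y = (v \<bullet> (B *\<^sub>v v)) / (v \<bullet> v)"
        using v B s by (simp add: R y mult_mat_vec[of _ n n] flip: s(2))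
      ultimately have "(v \<bullet> (B *\<^sub>v v)) / (v \<bullet> v) \<le> R x" by simp
      then show ?thesis using pos by (simp add: R pos_divide_le_eq)
    qed
  qed
qed

text \<open>
  The maximum \<open>ev\<close> of the Rayleigh quotient is an eigenvalue: \<open>ev \<cdot> 1 - B\<close> is positive
  semidefinite and its quadratic form vanishes at a maximiser, which therefore lies in the kernel.
  The diagonal entries of \<open>B\<close> are the values of the quotient at the unit vectors.
\<close>
lemma real_symmetric_diag_le_eigenvalue:
  fixes B :: "real mat"
  assumes B: "B \<in> carrier_mat n n" "B\<^sup>T = B" and n: "n > 0"
  obtains ev where "eigenvalue B ev" "\<And>i. i < n \<Longrightarrow> B $$ (i, i) \<le> ev"
proof -
  obtain x where x: "x \<in> carrier_vec n" "x \<bullet> x = 1"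
    and max: "\<And>v. v \<in> carrier_vec n \<Longrightarrow> v \<bullet> (B *\<^sub>v v) \<le> (x \<bullet> (B *\<^sub>v x)) * (v \<bullet> v)"
    using rayleigh_max_attained[OF B(1) n] by blast
  define ev where "ev = x \<bullet> (B *\<^sub>v x)"
  define M where "M = ev \<cdot>\<^sub>m 1\<^sub>m n - B"
  have "B $$ (j, i) = B $$ (i, j)" if "i < n" "j < n" for i j
    using that B index_transpose_mat(1)[of i B j] by simp
  then have M: "M \<in> carrier_mat n n" "M\<^sup>T = M"
    using B(1)
    by (auto simp: M_def mat_eq_iff)
  have Mv: "M *\<^sub>v v = ev \<cdot>\<^sub>v v - B *\<^sub>v v" if "v \<in> carrier_vec n" for v
  proof -
    have "(ev \<cdot>\<^sub>m 1\<^sub>m n) *\<^sub>v v = ev \<cdot>\<^sub>v v"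
      using that by (auto simp: scalar_prod_def vec_eq_iff if_distrib[of "\<lambda>x. x * _"]
          if_distrib[of "\<lambda>x. _ * x"] cong: if_cong)
    then show ?thesis
      using that B by (simp add: M_def minus_mult_distrib_mat_vec[of _ n n])
  qed
  have q: "v \<bullet> (M *\<^sub>v v) = ev * (v \<bullet> v) - v \<bullet> (B *\<^sub>v v)" if "v \<in> carrier_vec n" for v
    using that B by (simp add: Mv scalar_prod_minus_distrib[of _ n])
  have "M *\<^sub>v x = 0\<^sub>v n"
    using max by (intro real_symmetric_psd_null[OF M _ x(1)]) (simp_all add: q ev_def x)
  then have "B *\<^sub>v x = ev \<cdot>\<^sub>v x" 
    using x B by (auto simp: Mv vec_eq_iff)
  moreover have "x \<noteq> 0\<^sub>v n" using x by auto
  ultimately have "eigenvalue B ev"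
    using B x by (auto simp: eigenvalue_def eigenvector_def)
  moreover have "B $$ (i, i) \<le> ev" if "i < n" for i
    using max[of "unit_vec n i"] that B by (simp add: ev_def)
  ultimately show ?thesis by (rule that)
qed

text \<open>
  The squared column norms of \<open>S\<close> are the diagonal entries of \<open>S\<^sup>T S\<close>, and the squared largest
  singular value is the largest root of its characteristic polynomial. Without a real eigenvalue
  the list of roots could be empty and \<^const>\<open>sing_val\<close> an arbitrary value, so both claims rest on
  the existence of an eigenvalue above the diagonal.
\<close>
lemma sing_val_1_col_bounds:
  fixes S :: "real mat"
  assumes l: "l < dim_col S"
  shows "0 \<le> sing_val S 1" and "(\<Sum>i<dim_row S. (S $$ (i, l))\<^sup>2) \<le> (sing_val S 1)\<^sup>2"
proof -
  define B where "B = S\<^sup>T * S"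
  have B: "B \<in> carrier_mat (dim_col S) (dim_col S)" unfolding B_def by (rule mult_carrier_mat) auto
  have "B\<^sup>T = B"
    unfolding B_def by (subst transpose_mult[of _ "dim_col S" "dim_row S" _ "dim_col S"]) auto
  then obtain ev where ev: "eigenvalue B ev" "\<And>i. i < dim_col S \<Longrightarrow> B $$ (i, i) \<le> ev"
    using real_symmetric_diag_le_eigenvalue[OF B] l by auto
  define xs where "xs = sorted_list_of_multiset (proots (char_poly B))"
  have "char_poly B \<noteq> 0" using degree_monic_char_poly[OF B] by auto
  then have "ev \<in> set xs"
    using ev(1) eigenvalue_root_char_poly[OF B] by (simp add: xs_def)
  moreover have "sorted xs" by (simp add: xs_def)
  ultimately have "ev \<le> xs ! (length xs - 1)" "xs \<noteq> []"
    by (auto simp: in_set_conv_nth intro!: sorted_nth_mono)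
  then have "ev \<le> rev xs ! 0" by (simp add: rev_nth)
  moreover have "(\<Sum>i<dim_row S. (S $$ (i, l))\<^sup>2) = B $$ (l, l)"
    using l by (simp add: B_def scalar_prod_def lessThan_atLeast0 power2_eq_square)
  moreover have "0 \<le> (\<Sum>i<dim_row S. (S $$ (i, l))\<^sup>2)" by (simp add: sum_nonneg)
  ultimately show "0 \<le> sing_val S 1" "(\<Sum>i<dim_row S. (S $$ (i, l))\<^sup>2) \<le> (sing_val S 1)\<^sup>2"
    using ev(2)[OF l] by (simp_all add: sing_val_def B_def[symmetric] xs_def[symmetric])
qed

section \<open>Uniform samples of a fixed size\<close>

text \<open>
  Double counting: every \<open>j \<in> X\<close> lies in as many \<open>b\<close>-element subsets of \<open>X\<close> as there are
  \<open>(b - 1)\<close>-element subsets of \<open>X - {j}\<close>.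
\<close>
lemma sum_card_subsets:
  fixes Y :: "'a \<Rightarrow> real"
  assumes X: "finite X" and b: "1 \<le> b"
  shows "(\<Sum>T | T \<subseteq> X \<and> card T = b. \<Sum>j\<in>T. Y j)
    = real ((card X - 1) choose (b - 1)) * (\<Sum>j\<in>X. Y j)"
proof -
  define F where "F = {T. T \<subseteq> X \<and> card T = b}"
  have finF: "finite F" using X by (simp add: F_def)
  have card: "card {T \<in> F. j \<in> T} = (card X - 1) choose (b - 1)" if j: "j \<in> X" for j
  proof -
    have "bij_betw (insert j) {T. T \<subseteq> X - {j} \<and> card T = b - 1} {T \<in> F. j \<in> T}"
    proof (rule bij_betwI[where g = "\<lambda>T. T - {j}"])
      show "insert j \<in> {T. T \<subseteq> X - {j} \<and> card T = b - 1} \<rightarrow> {T \<in> F. j \<in> T}"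
      proof (rule Pi_I)
        fix T assume T: "T \<in> {T. T \<subseteq> X - {j} \<and> card T = b - 1}"
        then have "finite T" "j \<notin> T" using X finite_subset[of T "X - {j}"] by auto
        then show "insert j T \<in> {T \<in> F. j \<in> T}" using T b j by (auto simp: F_def)
      qed
      show "(\<lambda>T. T - {j}) \<in> {T \<in> F. j \<in> T} \<rightarrow> {T. T \<subseteq> X - {j} \<and> card T = b - 1}"
      proof (rule Pi_I)
        fix T assume "T \<in> {T \<in> F. j \<in> T}"
        then show "T - {j} \<in> {T. T \<subseteq> X - {j} \<and> card T = b - 1}"
          by (auto simp: F_def card_Diff_singleton)
      qed
    qed (blast+)
    then have "card {T. T \<subseteq> X - {j} \<and> card T = b - 1} = card {T \<in> F. j \<in> T}"
      by (rule bij_betw_same_card)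
    moreover have "card {T. T \<subseteq> X - {j} \<and> card T = b - 1} = (card X - 1) choose (b - 1)"
      using X j by (simp add: n_subsets)
    ultimately show ?thesis by (simp only:)
  qed
  have "(\<Sum>T\<in>F. \<Sum>j\<in>T. Y j) = (\<Sum>T\<in>F. \<Sum>j\<in>X. if j \<in> T then Y j else 0)"
  proof (rule sum.cong[OF refl])
    fix T assume "T \<in> F"
    then have "X \<inter> T = T" by (auto simp: F_def)
    then show "(\<Sum>j\<in>T. Y j) = (\<Sum>j\<in>X. if j \<in> T then Y j else 0)"
      using sum.inter_restrict[OF X, of Y T] by simp
  qed
  also have "\<dots> = (\<Sum>j\<in>X. \<Sum>T\<in>F. if j \<in> T then Y j else 0)" by (rule sum.swap)
  also have "\<dots> = (\<Sum>j\<in>X. real ((card X - 1) choose (b - 1)) * Y j)"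
  proof (rule sum.cong[OF refl])
    fix j assume "j \<in> X"
    then show "(\<Sum>T\<in>F. if j \<in> T then Y j else 0) = real ((card X - 1) choose (b - 1)) * Y j"
      using card by (simp add: finF flip: sum.inter_filter)
  qed
  finally show ?thesis by (simp add: F_def sum_distrib_left)
qed

lemma set_pmf_subset_samples:
  assumes "finite X" "b \<le> card X"
  shows "set_pmf (subset_samples X b) = {T. T \<subseteq> X \<and> card T = b}"
proof -
  have "card {T. T \<subseteq> X \<and> card T = b} > 0" using assms by (simp add: n_subsets)
  then show ?thesis unfolding subset_samples_def
    by (intro set_pmf_of_set) (auto simp: card_gt_0_iff)
qed

lemma expectation_subset_samples_sum:
  fixes Y :: "nat \<Rightarrow> real"
  assumes X: "finite X" and b: "1 \<le> b" "b \<le> card X"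
  shows "measure_pmf.expectation (subset_samples X b) (\<lambda>T. \<Sum>j\<in>T. Y j)
    = real b / real (card X) * (\<Sum>j\<in>X. Y j)"
proof -
  define F where "F = {T. T \<subseteq> X \<and> card T = b}"
  have cF: "card F = card X choose b" "finite F" using X by (simp_all add: F_def n_subsets)
  then have pos: "card F > 0" using b by simp
  then have "F \<noteq> {}" by auto
  have "measure_pmf.expectation (subset_samples X b) (\<lambda>T. \<Sum>j\<in>T. Y j)
      = real ((card X - 1) choose (b - 1)) / real (card F) * (\<Sum>j\<in>X. Y j)"
    unfolding subset_samples_def F_def[symmetric] integral_pmf_of_set[OF \<open>F \<noteq> {}\<close> cF(2)]
    using sum_card_subsets[OF X b(1), of Y] by (simp add: F_def)
  moreover have "b * (card X choose b) = card X * ((card X - 1) choose (b - 1))"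
    using b by (intro times_binomial_minus1_eq) simp
  then have "real b * real (card F) = real (card X) * real ((card X - 1) choose (b - 1))"
    by (metis cF(1) of_nat_mult)
  then have "real ((card X - 1) choose (b - 1)) / real (card F) = real b / real (card X)"
    using pos b by (simp add: field_simps)
  ultimately show ?thesis by (simp only:)
qed

text \<open>
  Both the scaled sum over the sample \<open>T\<close> and the full sum lie in \<open>[0, |X| M]\<close>, so they
  could only be \<open>|X| M\<close> apart by sitting at opposite ends. That is impossible, since they have the
  terms over \<open>T\<close> in common: if one of the sums is \<open>0\<close>, then these terms vanish and the
  other sum misses at least \<open>|T| M\<close>; if one of them is \<open>|X| M\<close>, then these terms all equal
  \<open>M\<close> and the other sum is positive. The proof makes this quantitative: both
  one-sided deviations are at most \<open>(|X| - |T|) M\<close>.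
\<close>
lemma sampled_mean_deviation_lt:
  fixes Y :: "'a \<Rightarrow> real"
  assumes X: "finite X" and T: "T \<subseteq> X" "T \<noteq> {}"
    and Y: "\<And>j. j \<in> X \<Longrightarrow> 0 \<le> Y j" "\<And>j. j \<in> X \<Longrightarrow> Y j \<le> M" and M: "0 < M"
  shows "\<bar>real (card X) / real (card T) * (\<Sum>j\<in>T. Y j) - (\<Sum>j\<in>X. Y j)\<bar> < real (card X) * M"
proof -
  define s w where "s = (\<Sum>j\<in>T. Y j)" and "w = (\<Sum>j\<in>X. Y j)"
  have finT: "finite T" using X T(1) finite_subset by blast
  have b: "0 < card T" "card T \<le> card X"
    using T X finT by (auto simp: card_gt_0_iff card_mono)
  have "w - s = (\<Sum>j\<in>X - T. Y j)"
    using X T by (simp add: w_def s_def sum_diff)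
  also have "\<dots> \<le> real (card (X - T)) * M"
    using Y(2) by (intro sum_bounded_above) simp
  finally have ws: "w - s \<le> (real (card X) - real (card T)) * M"
    using T finT b by (simp add: card_Diff_subset of_nat_diff)
  have sw: "s \<le> w" using X T Y by (auto simp: s_def w_def intro!: sum_mono2)
  have s: "0 \<le> s" "s \<le> real (card T) * M"
    using T Y sum_bounded_above[of T Y M] by (auto simp: s_def intro!: sum_nonneg)
  have lt: "(real (card X) - real (card T)) * M < real (card X) * M"
    using b M by simp
  have "1 \<le> real (card X) / real (card T)" using b by simp
  then have "s \<le> real (card X) / real (card T) * s"
    using s(1) mult_right_mono by fastforce
  moreover have "real (card X) / real (card T) * s - s \<le> (real (card X) - real (card T)) * M"
  proof -
    have "real (card X) / real (card T) * s - s = (real (card X) - real (card T)) * (s / real (card T))"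
      using b by (simp add: field_simps)
    also have "\<dots> \<le> (real (card X) - real (card T)) * M"
      using b s by (intro mult_left_mono) (simp_all add: divide_le_eq mult.commute)
    finally show ?thesis .
  qed
  ultimately show ?thesis
    unfolding s_def[symmetric] w_def[symmetric] using ws sw lt by linarith
qed

section \<open>Norms, submatrices and permutations\<close>

lemma bij_betw_pick:
  assumes "finite X"
  shows "bij_betw (pick X) {..<card X} X"
proof -
  have inj: "inj_on (pick X) {..<card X}"
    using pick_mono_le by (intro linorder_inj_onI) (force, auto)
  moreover have "pick X ` {..<card X} \<subseteq> X" using pick_in_set_le by auto
  ultimately show ?thesis
    using assms card_subset_eq[of X "pick X ` {..<card X}"] by (auto simp: bij_betw_def card_image)
qed

lemma frob_norm_sq: "(frob_norm A)\<^sup>2 = (\<Sum>i<dim_row A. \<Sum>j<dim_col A. (A $$ (i, j))\<^sup>2)"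
  by (simp add: frob_norm_def sum_nonneg)

lemma frob_norm_sq_column_submatrix:
  assumes "Ls \<subseteq> {..<dim_col S}"
  shows "(frob_norm (submatrix S UNIV Ls))\<^sup>2 = (\<Sum>l\<in>Ls. \<Sum>i<dim_row S. (S $$ (i, l))\<^sup>2)"
proof -
  have fin: "finite Ls" using assms finite_subset by blast
  have "{j. j < dim_col S \<and> j \<in> Ls} = Ls" using assms by auto
  then have "(frob_norm (submatrix S UNIV Ls))\<^sup>2
      = (\<Sum>i<dim_row S. \<Sum>j<card Ls. (S $$ (i, pick Ls j))\<^sup>2)"
    by (simp add: frob_norm_sq submatrix_def pick_UNIV)
  also have "\<dots> = (\<Sum>i<dim_row S. \<Sum>l\<in>Ls. (S $$ (i, l))\<^sup>2)"
    by (intro sum.cong refl sum.reindex_bij_betw[OF bij_betw_pick[OF fin]])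
  finally show ?thesis by (simp add: sum.swap[of _ Ls])
qed

lemma frob_norm_sq_permute:
  assumes A: "A \<in> carrier_mat m n" and p: "p permutes {..<m}" and q: "q permutes {..<n}"
  shows "(frob_norm A)\<^sup>2 = (\<Sum>i<m. \<Sum>j<n. (A $$ (p i, q j))\<^sup>2)"
proof -
  have "(\<Sum>i<m. \<Sum>j<n. (A $$ (p i, q j))\<^sup>2) = (\<Sum>i<m. \<Sum>j<n. (A $$ (p i, j))\<^sup>2)"
    by (intro sum.cong refl sum.reindex_bij_betw[OF permutes_imp_bij[OF q]])
  also have "\<dots> = (\<Sum>i<m. \<Sum>j<n. (A $$ (i, j))\<^sup>2)"
    by (rule sum.reindex_bij_betw[OF permutes_imp_bij[OF p]])
  finally show ?thesis using A by (simp add: frob_norm_sq)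
qed

lemma index_transpose_perm_mat_mult:
  assumes "p permutes {..<m}" "X \<in> carrier_mat m r" "i < m" "j < r"
  shows "((perm_mat m p)\<^sup>T * X) $$ (i, j) = X $$ (p i, j)"
proof -
  have "p i < m" using assms permutes_in_image by fastforce
  then show ?thesis
    using assms by (simp add: perm_mat_def scalar_prod_def if_distrib[of "\<lambda>x. x * _"] cong: if_cong)
qed

lemma index_perm_mat_mult:
  assumes "p permutes {..<m}" "X \<in> carrier_mat m r" "i < m" "j < r"
  shows "(perm_mat m p * X) $$ (p i, j) = X $$ (i, j)"
proof -
  have "p i < m" using assms permutes_in_image by fastforce
  moreover have "p i = p a \<longleftrightarrow> i = a" for a
    using permutes_inj[OF assms(1)] by (simp add: inj_eq)
  ultimately show ?thesis
    using assms by (simp add: perm_mat_def scalar_prod_def if_distrib[of "\<lambda>x. x * _"] cong: if_cong)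
qed

lemma index_mult_perm_mat:
  assumes "q permutes {..<n}" "X \<in> carrier_mat r n" "i < r" "j < n"
  shows "(X * perm_mat n q) $$ (i, j) = X $$ (i, q j)"
proof -
  have "q j < n" using assms permutes_in_image by fastforce
  then show ?thesis
    using assms by (simp add: perm_mat_def scalar_prod_def if_distrib[of "\<lambda>x. _ * x"] cong: if_cong)
qed

lemma the_mat_inverse_mult:
  fixes M :: "'a::field mat"
  assumes "M \<in> carrier_mat k k" "invertible_mat M"
  shows "the (mat_inverse M) \<in> carrier_mat k k" "the (mat_inverse M) * M = 1\<^sub>m k"
proof -
  obtain B where B: "M * B = 1\<^sub>m k" "B * M = 1\<^sub>m (dim_row B)"
    using assms by (auto simp: invertible_mat_def inverts_mat_def)
  have "dim_col (M * B) = k" "dim_col (B * M) = dim_row B" unfolding B by simp_all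
  then have "B \<in> carrier_mat k k" using assms(1) by auto
  then have "M \<in> Units (ring_mat TYPE('a) k ())"
    using B assms(1) by (auto simp: Units_def ring_mat_simps)
  then obtain C where C: "mat_inverse M = Some C"
    using mat_inverse(1)[OF assms(1), of "()"] by (cases "mat_inverse M") auto
  show "the (mat_inverse M) \<in> carrier_mat k k" "the (mat_inverse M) * M = 1\<^sub>m k"
    using mat_inverse(2)[OF assms(1) C] C by simp_all
qed

section \<open>Residual and Schur complement\<close>

text \<open>
  The product of \<open>U\<close> and the rows \<open>I\<close> of \<open>A\<close> reproduces those rows. In the
  other rows it replaces \<open>(A\<^sub>2\<^sub>1, A\<^sub>2\<^sub>2)\<close> by \<open>E (A\<^sub>1\<^sub>1, A\<^sub>1\<^sub>2)\<close>, which is correct in the columns \<open>J\<close>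
  because \<open>E A\<^sub>1\<^sub>1 = A\<^sub>2\<^sub>1\<close>. So only the Schur complement remains of the residual.
\<close>
lemma index_residual_permuted:
  fixes A A11 A12 A21 A22 E :: "real mat"
  assumes A: "A \<in> carrier_mat m n"
    and I: "I \<subseteq> {..<m}" "card I = k" and k: "k \<le> n"
    and p: "p permutes {..<m}" "\<And>i. i < k \<Longrightarrow> p i = pick I i"
    and q: "q permutes {..<n}"
    and blocks: "A11 \<in> carrier_mat k k" "A12 \<in> carrier_mat k (n - k)"
      "A21 \<in> carrier_mat (m - k) k" "A22 \<in> carrier_mat (m - k) (n - k)"
      "(perm_mat m p)\<^sup>T * (A * perm_mat n q) = four_block_mat A11 A12 A21 A22"
    and E: "E \<in> carrier_mat (m - k) k" "E * A11 = A21"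
    and ij: "i < m" "j < n"
  shows "(A - perm_mat m p * (1\<^sub>m k @\<^sub>r E) * submatrix A I UNIV) $$ (p i, q j)
    = (if i < k \<or> j < k then 0 else (A22 - E * A12) $$ (i - k, j - k))"
proof -
  define F where "F = four_block_mat A11 A12 A21 A22"
  define W where "W = 1\<^sub>m k @\<^sub>r E"
  define R where "R = submatrix A I UNIV"
  have km: "k \<le> m" using I card_mono[of "{..<m}" I] by simp
  have pm: "p i < m" if "i < m" for i using p(1) that permutes_in_image by fastforce
  have qn: "q j < n" using q ij permutes_in_image by fastforce
  have P: "perm_mat m p \<in> carrier_mat m m" by (simp add: perm_mat_def)
  have AQ: "A * perm_mat n q \<in> carrier_mat m n" using A by (simp add: perm_mat_def)
  have W: "W \<in> carrier_mat m k" using carrier_append_rows[OF one_carrier_mat E(1)] km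
    by (simp add: W_def)
  define PW where "PW = perm_mat m p * W"
  have PW: "PW \<in> carrier_mat m k" unfolding PW_def using P W by (rule mult_carrier_mat)
  have "{i. i < dim_row A \<and> i \<in> I} = I" using I A by auto
  then have R: "R \<in> carrier_mat k n" and R_index: "\<And>l j. l < k \<Longrightarrow> j < n \<Longrightarrow> R $$ (l, j) = A $$ (pick I l, j)"
    using A I by (auto simp: R_def submatrix_def pick_UNIV)
  have F_index: "F $$ (i, j) = A $$ (p i, q j)" if "i < m" for i
    using that ij A pm index_transpose_perm_mat_mult[OF p(1) AQ that ij(2)]
      index_mult_perm_mat[OF q A pm[OF that] ij(2)]
    by (simp add: F_def blocks(5)[symmetric])
  have "(A - PW * R) $$ (p i, q j) = A $$ (p i, q j) - (\<Sum>l<k. PW $$ (p i, l) * R $$ (l, q j))"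
    using A PW R pm[OF ij(1)] qn by (simp add: scalar_prod_def lessThan_atLeast0)
  also have "\<dots> = F $$ (i, j) - (\<Sum>l<k. W $$ (i, l) * F $$ (l, j))"
    using ij km qn by (simp add: PW_def index_perm_mat_mult[OF p(1) W] R_index F_index p(2))
  also have "\<dots> = (if i < k \<or> j < k then 0 else (A22 - E * A12) $$ (i - k, j - k))"
  proof (cases "i < k")
    case True
    have "(\<Sum>l<k. W $$ (i, l) * F $$ (l, j)) = (\<Sum>l<k. if l = i then F $$ (l, j) else 0)"
      using True E km by (intro sum.cong) (auto simp: W_def append_rows_def)
    then show ?thesis using True by simp
  next
    case False
    then have ik: "i - k < m - k" using ij by simp
    have W_low: "W $$ (i, l) = E $$ (i - k, l)" if "l < k" for l
      using False ij E that by (simp add: W_def append_rows_def)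
    show ?thesis
    proof (cases "j < k")
      case True
      have "(\<Sum>l<k. W $$ (i, l) * F $$ (l, j)) = (E * A11) $$ (i - k, j)"
        using True ik E(1) blocks(1-4) W_low
        by (simp add: F_def scalar_prod_def lessThan_atLeast0)
      then show ?thesis using True False ij blocks by (simp add: E F_def)
    next
      case j: False
      have "(\<Sum>l<k. W $$ (i, l) * F $$ (l, j)) = (E * A12) $$ (i - k, j - k)"
        using j ik ij E(1) blocks(1-4) W_low
        by (simp add: F_def scalar_prod_def lessThan_atLeast0)
      then show ?thesis using j False ij blocks E by (simp add: F_def)
    qed
  qed
  finally show ?thesis by (simp add: PW_def W_def R_def)
qed

lemma frob_norm_residual:
  fixes A A11 A12 A21 A22 E :: "real mat"
  assumes A: "A \<in> carrier_mat m n"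
    and I: "I \<subseteq> {..<m}" "card I = k" and k: "k \<le> n"
    and p: "p permutes {..<m}" "\<And>i. i < k \<Longrightarrow> p i = pick I i"
    and q: "q permutes {..<n}"
    and blocks: "A11 \<in> carrier_mat k k" "A12 \<in> carrier_mat k (n - k)"
      "A21 \<in> carrier_mat (m - k) k" "A22 \<in> carrier_mat (m - k) (n - k)"
      "(perm_mat m p)\<^sup>T * (A * perm_mat n q) = four_block_mat A11 A12 A21 A22"
    and E: "E \<in> carrier_mat (m - k) k" "E * A11 = A21"
  shows "(frob_norm (A - perm_mat m p * (1\<^sub>m k @\<^sub>r E) * submatrix A I UNIV))\<^sup>2
    = (frob_norm (A22 - E * A12))\<^sup>2"
proof -
  define S where "S = A22 - E * A12"
  have S: "dim_row S = m - k" "dim_col S = n - k" using E blocks by (simp_all add: S_def)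
  have km: "k \<le> m" using I card_mono[of "{..<m}" I] by simp
  have drop_zeros: "(\<Sum>i<r. if i < k then 0 else g (i - k)) = (\<Sum>i<r - k. g i)"
    if "k \<le> r" for r and g :: "nat \<Rightarrow> real"
  proof -
    obtain d where "r = k + d" using \<open>k \<le> r\<close> le_Suc_ex by blast
    have "(\<Sum>i<k + d. if i < k then 0 else g (i - k)) = (\<Sum>i<d. g i)" by (induction d) simp_all
    then show ?thesis by (simp add: \<open>r = k + d\<close>)
  qed
  define D where "D = A - perm_mat m p * (1\<^sub>m k @\<^sub>r E) * submatrix A I UNIV"
  have "{i. i < dim_row A \<and> i \<in> I} = I" using I A by auto
  then have "dim_row (submatrix A I UNIV) = k" "dim_col (submatrix A I UNIV) = n"
    using A I by (auto simp: dim_submatrix)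
  then have "D \<in> carrier_mat m n"
    using A by (auto simp: D_def perm_mat_def)
  from frob_norm_sq_permute[OF this p(1) q]
  have "(frob_norm D)\<^sup>2 = (\<Sum>i<m. \<Sum>j<n. (D $$ (p i, q j))\<^sup>2)" .
  also have "\<dots> = (\<Sum>i<m. if i < k then 0
      else (\<Sum>j<n. if j < k then 0 else (S $$ (i - k, j - k))\<^sup>2))"
    unfolding D_def
    by (intro sum.cong refl)
      (auto simp: index_residual_permuted[OF A I k p q blocks E] S_def[symmetric] intro!: sum.cong)
  also have "\<dots> = (\<Sum>i<m - k. \<Sum>j<n - k. (S $$ (i, j))\<^sup>2)"
    using drop_zeros[OF km, of "\<lambda>i. \<Sum>j<n. if j < k then 0 else (S $$ (i, j - k))\<^sup>2"]
      drop_zeros[OF k, of "\<lambda>j. (S $$ (_, j))\<^sup>2"] by simp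
  finally show ?thesis by (simp add: frob_norm_sq S D_def[symmetric] S_def[symmetric])
qed

section \<open>Sampled norm of the residual\<close>

theorem lemma3p5:
  fixes A A11 A12 A21 A22 E S P Q U \<E> :: "real mat"
    and m n k b :: nat
    and I J J' :: "nat set"
    and p q :: "nat \<Rightarrow> nat"
    and L :: "nat set \<Rightarrow> nat set"
    and \<theta> :: "nat set \<Rightarrow> real"
    and c f :: real
  assumes A: "A \<in> carrier_mat m n"
    and I: "I \<subseteq> {..<m}" "card I = k"
    and J: "J \<subseteq> {..<n}" "card J = k"
    and J': "J' = {..<n} - J"
    (* the rows I come first, the other rows follow in any order *)
    and P: "P = perm_mat m p" "p permutes {..<m}" "\<And>i. i < k \<Longrightarrow> p i = pick I i"
    (* the columns J come first, the other columns follow in their original order *)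
    and Q: "Q = perm_mat n q" "q permutes {..<n}" "\<And>j. j < k \<Longrightarrow> q j = pick J j"
      "\<And>j. j < n - k \<Longrightarrow> q (k + j) = pick J' j"
    and blocks: "A11 \<in> carrier_mat k k" "A12 \<in> carrier_mat k (n - k)"
      "A21 \<in> carrier_mat (m - k) k" "A22 \<in> carrier_mat (m - k) (n - k)"
      "P\<^sup>T * (A * Q) = four_block_mat A11 A12 A21 A22"
    and A11: "A11 = submatrix A I J" "invertible_mat A11"
    and E: "E = A21 * the (mat_inverse A11)"
    and S: "S = A22 - E * A12"
    and factorization: "A * Q =
      P * four_block_mat (1\<^sub>m k) (0\<^sub>m k (m - k)) E (1\<^sub>m (m - k))
        * four_block_mat A11 A12 (0\<^sub>m (m - k) k) S"
    and U: "U = P * (1\<^sub>m k @\<^sub>r E)"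
    and \<E>: "\<E> = A - U * submatrix A I UNIV"
    and c: "c \<ge> 1" "max_norm E \<le> c"
    and f: "f \<ge> 1"
    and b: "1 \<le> b" "b \<le> n - k"
    and L: "\<And>T. T \<subseteq> J' \<Longrightarrow> card T = b \<Longrightarrow> L T \<subseteq> {..<n - k} \<and> entries_at J' (L T) = T"
    and \<theta>: "\<And>T. \<theta> T = real (n - k) / real b * (frob_norm (submatrix S UNIV (L T)))\<^sup>2"
  (* If sing_val A (k + 1) = 0, then S = 0 and the event below is certain, so the tail bound
     needs sing_val A (k + 1) > 0. *)
  shows "measure_pmf.expectation (subset_samples J' b) \<theta> = (frob_norm \<E>)\<^sup>2 \<and>
    ((\<forall>i\<in>{1..k}. sing_val A11 i \<ge> sing_val A i / f) \<and>
     (\<forall>j\<in>{1..min m n - k}. sing_val S j \<le> sing_val A (k + j) * f) \<and>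
     max_norm (the (mat_inverse A11) * A12) \<le> c \<and>
     0 < sing_val A (k + 1)
     \<longrightarrow>
     measure_pmf.prob (subset_samples J' b)
       {T. \<bar>\<theta> T - (frob_norm \<E>)\<^sup>2\<bar> \<ge> (real (n - k) * f\<^sup>2) * (sing_val A (k + 1))\<^sup>2}
     \<le> 2 * exp (- 2 * real b))"
proof -
  \<comment> \<open>The squared norm of the column of \<open>S\<close> that belongs to the column \<open>j\<close> of \<open>A\<close>; indexing by
    the sampled columns themselves makes \<open>\<theta> T\<close> a plain sum over \<open>T\<close>.\<close>
  define Y where
    "Y j = (\<Sum>i<dim_row S. (S $$ (i, inv_into {..<n - k} (pick J') j))\<^sup>2)" for j
  have k: "k \<le> n" using J card_mono[of "{..<n}" J] by simp
  have J'_card: "finite J'" "card J' = n - k"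
    using J by (auto simp: J' card_Diff_subset finite_subset)
  have bij: "bij_betw (pick J') {..<n - k} J'"
    using bij_betw_pick[OF J'_card(1)] J'_card(2) by simp
  have Y_pick: "Y (pick J' l) = (\<Sum>i<dim_row S. (S $$ (i, l))\<^sup>2)" if "l < n - k" for l
    using that bij by (simp add: Y_def bij_betw_def inv_into_f_f)
  have E': "E \<in> carrier_mat (m - k) k" "E * A11 = A21"
    using blocks the_mat_inverse_mult[OF blocks(1) A11(2)]
    by (simp_all add: E assoc_mult_mat[of _ "m - k" k _ k _ k])
  have S_dim: "dim_row S = m - k" "dim_col S = n - k" using E'(1) blocks by (simp_all add: S)
  have total: "(frob_norm \<E>)\<^sup>2 = (\<Sum>j\<in>J'. Y j)"
  proof -
    have "(frob_norm \<E>)\<^sup>2 = (frob_norm S)\<^sup>2"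
      using frob_norm_residual[OF A I k P(2,3) Q(2) blocks(1-4) _ E'] blocks(5)
      by (simp add: \<E> U S P(1) Q(1))
    also have "\<dots> = (\<Sum>l<n - k. Y (pick J' l))"
      unfolding frob_norm_sq S_dim by (subst sum.swap) (simp add: Y_pick S_dim)
    also have "\<dots> = (\<Sum>j\<in>J'. Y j)" by (rule sum.reindex_bij_betw[OF bij])
    finally show ?thesis .
  qed
  have \<theta>_sum: "\<theta> T = real (n - k) / real b * (\<Sum>j\<in>T. Y j)" if T: "T \<subseteq> J'" "card T = b" for T
  proof -
    have LT: "L T \<subseteq> {..<n - k}" "pick J' ` L T = T"
      using L[OF T] by (simp_all add: entries_at_def)
    then have "inj_on (pick J') (L T)" using bij by (meson bij_betw_def inj_on_subset)
    then have "(\<Sum>j\<in>T. Y j) = (\<Sum>l\<in>L T. Y (pick J' l))"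
      using LT(2) sum.reindex[of "pick J'" "L T" Y] by simp
    also have "\<dots> = (frob_norm (submatrix S UNIV (L T)))\<^sup>2"
      using LT(1) by (subst frob_norm_sq_column_submatrix) (auto simp: S_dim Y_pick intro!: sum.cong)
    finally show ?thesis by (simp add: \<theta>)
  qed
  have supp: "set_pmf (subset_samples J' b) = {T. T \<subseteq> J' \<and> card T = b}"
    using set_pmf_subset_samples[OF J'_card(1)] b by (simp add: J'_card)
  have "measure_pmf.expectation (subset_samples J' b) \<theta>
      = measure_pmf.expectation (subset_samples J' b) (\<lambda>T. real (n - k) / real b * (\<Sum>j\<in>T. Y j))"
    using \<theta>_sum supp by (intro integral_cong_AE) (auto simp: AE_measure_pmf_iff)
  also have "\<dots> = (frob_norm \<E>)\<^sup>2"
    using b expectation_subset_samples_sum[OF J'_card(1) b(1), of Y] by (simp add: J'_card total)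
  finally have expectation: "measure_pmf.expectation (subset_samples J' b) \<theta> = (frob_norm \<E>)\<^sup>2" .

  have tail: "measure_pmf.prob (subset_samples J' b)
       {T. \<bar>\<theta> T - (frob_norm \<E>)\<^sup>2\<bar> \<ge> (real (n - k) * f\<^sup>2) * (sing_val A (k + 1))\<^sup>2}
     \<le> 2 * exp (- 2 * real b)"
    if S_le: "\<forall>j\<in>{1..min m n - k}. sing_val S j \<le> sing_val A (k + j) * f"
      and pos: "0 < sing_val A (k + 1)"
  proof -
    define M where "M = f\<^sup>2 * (sing_val A (k + 1))\<^sup>2"
    have "0 < M" using f pos by (simp add: M_def)
    have Y_le: "Y j \<le> M" if j: "j \<in> J'" for j
    proof -
      obtain l where l: "l < n - k" "j = pick J' l" using bij j by (auto simp: bij_betw_def)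
      show ?thesis
      proof (cases "k < m")
        case True
        have sq: "Y j \<le> (sing_val S 1)\<^sup>2"
          using sing_val_1_col_bounds(2)[of l S] l by (simp add: Y_pick S_dim)
        have "0 \<le> sing_val S 1" using sing_val_1_col_bounds(1)[of l S] l by (simp add: S_dim)
        moreover have "sing_val S 1 \<le> sing_val A (k + 1) * f" using bspec[OF S_le, of 1] True b by simp
        ultimately have "(sing_val S 1)\<^sup>2 \<le> (sing_val A (k + 1) * f)\<^sup>2" by (simp add: power_mono)
        with sq show ?thesis by (simp add: M_def power_mult_distrib mult.commute)
      next
        \<comment> \<open>If \<open>k = m\<close>, then \<open>S\<close> has no rows, and there is no \<open>j\<close> to which \<open>S_le\<close> applies.\<close>
        case False
        then show ?thesis using \<open>0 < M\<close> by (simp add: Y_def S_dim)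
      qed
    qed
    have "T \<notin> {T. \<bar>\<theta> T - (frob_norm \<E>)\<^sup>2\<bar> \<ge> (real (n - k) * f\<^sup>2) * (sing_val A (k + 1))\<^sup>2}"
      if "T \<in> set_pmf (subset_samples J' b)" for T
    proof -
      have T: "T \<subseteq> J'" "card T = b" using that supp by auto
      then have "T \<noteq> {}" using b by auto
      from sampled_mean_deviation_lt[OF J'_card(1) T(1) this _ Y_le \<open>0 < M\<close>]
      have "\<bar>\<theta> T - (frob_norm \<E>)\<^sup>2\<bar> < real (n - k) * M"
        by (simp add: \<theta>_sum[OF T] T(2) J'_card(2) total Y_def sum_nonneg)
      then show ?thesis unfolding M_def mult.assoc mem_Collect_eq not_le .
    qed
    then have "set_pmf (subset_samples J' b) \<inter>
        {T. \<bar>\<theta> T - (frob_norm \<E>)\<^sup>2\<bar> \<ge> (real (n - k) * f\<^sup>2) * (sing_val A (k + 1))\<^sup>2} = {}"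
      by blast
    then have "measure_pmf.prob (subset_samples J' b)
        {T. \<bar>\<theta> T - (frob_norm \<E>)\<^sup>2\<bar> \<ge> (real (n - k) * f\<^sup>2) * (sing_val A (k + 1))\<^sup>2} = 0"
      by (simp add: measure_pmf_zero_iff)
    then show ?thesis by simp
  qed
  show ?thesis using expectation tail by blast
qed

end
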